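(* Let $A>0$, $d\ge1$, $X=[0,1]^d$, $Y=[-A,A]$, let $\varrho$ be a Borel probability measure on $X\times Y$ with marginal $\varrho_X$ on $X$ and regression function $f_\varrho$, and let $s>0$. Suppose $f_\varrho\in\mathcal{A}^s$, and let $C$ be a constant and, for each integer $N\ge1$, let $\mathbf{M}_N=\{M_v\}_{v\in T_N}$ be an admissible family with $|T_N|=N$ such that $\|f_\varrho-Q_{\mathbf{M}_N}f_\varrho\|\le C N^{-s}$ (these exist by the definition of $\mathcal{A}^s$). For each integer $m\ge1$ let $f_{\mathbf{z}}$ be the estimator built from a sample $\mathbf{z}\sim\varrho^m$ and from the family $\mathbf{M}=\mathbf{M}_N$ with $N=[m^{1/(1+2s)}]$ (integer part). Then $$E\,\|f_\varrho-f_{\mathbf{z}}\|^2=O\left(\left(\frac1m\right)^{\frac{2s}{1+2s}}\right),$$ i.e. there is a constant $C'$ independent of $m$ such that $E\,\|f_\varrho-f_{\mathbf{z}}\|^2\le C' m^{-2s/(1+2s)}$ for all $m\ge1$, the expectation being over $\mathbf{z}\sim\varrho^m$ and $\|\cdot\|$ being the norm of $L^2(X,\varrho_X)$.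
   Context: Disintegrate $d\varrho(x,y)=d\varrho(y|x)\,d\varrho_X(x)$, where $\varrho_X(S)=\varrho(S\times Y)$. The regression function is $f_\varrho(x)=\int_Y y\,d\varrho(y|x)$. The norm $\|\cdot\|$ is that of $L^2(X,\varrho_X)$. The sample $\mathbf{z}=(z_1,\dots,z_m)$ consists of $m$ independent observations $z_j=(x_j,y_j)\in X\times Y$, identically distributed according to $\varrho$ (so $\mathbf{z}\sim\varrho^m$). An admissible family is a finite family $\mathbf{M}=\{M_v\}_{v\in T}$ of measurable functions on $X$ with $0\le M_v(x)\le 1$ for all $v\in T$, $x\in X$, and $\sum_{v\in T}M_v(x)=1$ for all $x\in X$. For such a family define for $f\in L^2(X,\varrho_X)$ $$Q_{\mathbf{M}}f(x)=\sum_{v\in T}c_v(f)M_v(x),\quad c_v(f)=\frac{\alpha_v(f)}{\varrho_v},\quad \alpha_v(f)=\int_X fM_v\,d\varrho_X,\quad \varrho_v=\int_X M_v\,d\varrho_X,$$ with the convention $c_v(f)=0$ if $\varrho_v=0$. The estimator (depending on $\mathbf{M}$ and $\mathbf{z}$) is $$f_{\mathbf{z}}(x)=\sum_{v\in T}c_v(\mathbf{z})M_v(x),\quad c_v(\mathbf{z})=\frac{\alpha_v(\mathbf{z})}{\varrho_v(\mathbf{z})},\quad \alpha_v(\mathbf{z})=\frac1m\sum_{j=1}^m y_jM_v(x_j),\quad \varrho_v(\mathbf{z})=\frac1m\sum_{j=1}^m M_v(x_j),$$ with the convention $c_v(\mathbf{z})=0$ if $\varrho_v(\mathbf{z})=0$.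 The class $\mathcal{A}^s$ ($s>0$): $f\in\mathcal{A}^s$ if $f\in L^2(X,\varrho_X)$ and there is a constant $C$ such that for every integer $N\ge1$ there is an admissible family $\mathbf{M}=\{M_v\}_{v\in T}$ with $|T|=N$ and $\|f-Q_{\mathbf{M}}f\|\le CN^{-s}$. *)

theory Defs
  imports "HOL-Probability.Probability"
begin

abbreviation unit_cube :: "(real ^ 'd) set" where
  "unit_cube \<equiv> {x. \<forall>i. 0 \<le> x $ i \<and> x $ i \<le> 1}"

definition borel_probability_on :: "'a::topological_space set \<Rightarrow> 'a measure \<Rightarrow> bool" where
  "borel_probability_on S \<rho> \<longleftrightarrow> prob_space \<rho> \<and> sets \<rho> = sets (restrict_space borel S)"

definition marginal ::
    "'a::topological_space set \<Rightarrow> ('a \<times> real) measure \<Rightarrow> 'a measure" where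
  "marginal X \<rho> = distr \<rho> (restrict_space borel X) fst"

text \<open>\<open>\<kappa> x\<close> is the conditional distribution \<open>\<rho>(\<cdot>|x)\<close>, a Markov kernel from
  \<open>X\<close> to \<open>Y\<close>. It is determined by \<open>\<rho>\<close> only up to a null set of the marginal, so it is
  treated as a parameter rather than fixed by a choice operator.\<close>

definition disintegration ::
    "'a::topological_space set \<Rightarrow> real set \<Rightarrow> ('a \<times> real) measure \<Rightarrow> ('a \<Rightarrow> real measure) \<Rightarrow> bool" where
  "disintegration X Y \<rho> \<kappa> \<longleftrightarrow>
     \<kappa> \<in> restrict_space borel X \<rightarrow>\<^sub>M prob_algebra (restrict_space borel Y) \<and>
     (\<forall>S\<in>sets \<rho>. emeasure \<rho> S = (\<integral>\<^sup>+x. emeasure (\<kappa> x) {y \<in> Y. (x, y) \<in> S} \<partial>marginal X \<rho>))"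

definition regression :: "('a \<Rightarrow> real measure) \<Rightarrow> 'a \<Rightarrow> real" where
  "regression \<kappa> x = (\<integral>y. y \<partial>\<kappa> x)"

definition in_L2 :: "'a measure \<Rightarrow> ('a \<Rightarrow> real) \<Rightarrow> bool" where
  "in_L2 \<mu> f \<longleftrightarrow> f \<in> borel_measurable \<mu> \<and> integrable \<mu> (\<lambda>x. (f x)\<^sup>2)"

definition L2_norm :: "'a measure \<Rightarrow> ('a \<Rightarrow> real) \<Rightarrow> real" where
  "L2_norm \<mu> f = sqrt (\<integral>x. (f x)\<^sup>2 \<partial>\<mu>)"

text \<open>Of \<open>\<mu>\<close> only the underlying measurable space matters here.\<close>

definition admissible :: "'a measure \<Rightarrow> 'v set \<Rightarrow> ('v \<Rightarrow> 'a \<Rightarrow> real) \<Rightarrow> bool" where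
  "admissible \<mu> T M \<longleftrightarrow>
     finite T \<and>
     (\<forall>v\<in>T. M v \<in> borel_measurable \<mu>) \<and>
     (\<forall>v\<in>T. \<forall>x\<in>space \<mu>. 0 \<le> M v x \<and> M v x \<le> 1) \<and>
     (\<forall>x\<in>space \<mu>. (\<Sum>v\<in>T. M v x) = 1)"

definition Q_coeff :: "'a measure \<Rightarrow> ('a \<Rightarrow> real) \<Rightarrow> ('a \<Rightarrow> real) \<Rightarrow> real" where
  "Q_coeff \<mu> g f =
     (if (\<integral>x. g x \<partial>\<mu>) = 0 then 0 else (\<integral>x. f x * g x \<partial>\<mu>) / (\<integral>x. g x \<partial>\<mu>))"

definition Q_op ::
    "'a measure \<Rightarrow> 'v set \<Rightarrow> ('v \<Rightarrow> 'a \<Rightarrow> real) \<Rightarrow> ('a \<Rightarrow> real) \<Rightarrow> 'a \<Rightarrow> real" where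
  "Q_op \<mu> T M f x = (\<Sum>v\<in>T. Q_coeff \<mu> (M v) f * M v x)"

definition emp_alpha :: "nat \<Rightarrow> (nat \<Rightarrow> 'a \<times> real) \<Rightarrow> ('a \<Rightarrow> real) \<Rightarrow> real" where
  "emp_alpha m z g = (1 / real m) * (\<Sum>j=1..m. snd (z j) * g (fst (z j)))"

definition emp_mass :: "nat \<Rightarrow> (nat \<Rightarrow> 'a \<times> real) \<Rightarrow> ('a \<Rightarrow> real) \<Rightarrow> real" where
  "emp_mass m z g = (1 / real m) * (\<Sum>j=1..m. g (fst (z j)))"

definition emp_coeff :: "nat \<Rightarrow> (nat \<Rightarrow> 'a \<times> real) \<Rightarrow> ('a \<Rightarrow> real) \<Rightarrow> real" where
  "emp_coeff m z g = (if emp_mass m z g = 0 then 0 else emp_alpha m z g / emp_mass m z g)"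

definition estimator ::
    "'v set \<Rightarrow> ('v \<Rightarrow> 'a \<Rightarrow> real) \<Rightarrow> nat \<Rightarrow> (nat \<Rightarrow> 'a \<times> real) \<Rightarrow> 'a \<Rightarrow> real" where
  "estimator T M m z x = (\<Sum>v\<in>T. emp_coeff m z (M v) * M v x)"

definition sample_measure :: "nat \<Rightarrow> 'b measure \<Rightarrow> (nat \<Rightarrow> 'b) measure" where
  "sample_measure m \<rho> = PiM {1..m} (\<lambda>_. \<rho>)"

text \<open>Index sets of natural numbers are no restriction: the families are finite.\<close>

definition approx_class :: "'a measure \<Rightarrow> real \<Rightarrow> ('a \<Rightarrow> real) set" where
  "approx_class \<mu> s =
     {f. in_L2 \<mu> f \<and>
       (\<exists>C. \<forall>N\<ge>1. \<exists>(T :: nat set) M. admissible \<mu> T M \<and> card T = N \<and>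
          L2_norm \<mu> (\<lambda>x. f x - Q_op \<mu> T M f x) \<le> C * real N powr (- s))}"

end

theory Submission
  imports Defs
begin

text \<open>
  Since the weights sum to one, convexity of the square reduces the variance part of the risk to
  \<open>\<Sum>v. \<rho>\<^sub>v E (c\<^sub>v(z) - c\<^sub>v)\<^sup>2\<close>. The key identity is
  \<open>\<rho>\<^sub>v (c\<^sub>v(z) - c\<^sub>v) = (\<alpha>\<^sub>v(z) - c\<^sub>v \<rho>\<^sub>v(z)) + (\<rho>\<^sub>v - \<rho>\<^sub>v(z)) (c\<^sub>v(z) - c\<^sub>v)\<close>:
  the first summand and \<open>\<rho>\<^sub>v - \<rho>\<^sub>v(z)\<close> are centred sample means of variance \<open>O(\<rho>\<^sub>v / m)\<close>, while
  \<open>|c\<^sub>v(z) - c\<^sub>v| \<le> 2A\<close>. Hence every term of the sum is \<open>O(1 / m)\<close>, without any lower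
  bound on the random denominator \<open>\<rho>\<^sub>v(z)\<close>. The total risk is \<open>O(N powr (-2s) + N / m)\<close>, and the
  prescribed \<open>N\<close> balances the two contributions.
\<close>

section \<open>Elementary estimates: sample means, convexity, the size of \<open>N\<close>\<close>

text \<open>Independence and centring make the off-diagonal terms of the expanded square vanish, so
  only the \<open>m\<close> diagonal terms survive, against a prefactor of 1 over the square of
  \<open>m\<close>. For \<open>m = 0\<close> both sides are 0, by division by zero.\<close>

lemma second_moment_sample_mean:
  fixes h :: "'a \<Rightarrow> real"
  assumes "prob_space P" and h: "h \<in> borel_measurable P"
    and h2: "integrable P (\<lambda>x. (h x)\<^sup>2)" and mean: "(\<integral>x. h x \<partial>P) = 0"
  shows "integrable (sample_measure m P) (\<lambda>z. ((1 / real m) * (\<Sum>j=1..m. h (z j)))\<^sup>2)"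
    and "(\<integral>z. ((1 / real m) * (\<Sum>j=1..m. h (z j)))\<^sup>2 \<partial>sample_measure m P)
           = (\<integral>x. (h x)\<^sup>2 \<partial>P) / real m"
proof -
  interpret P: prob_space P by fact
  interpret product_sigma_finite "\<lambda>_::nat. P" by unfold_locales
  let ?S = "sample_measure m P" and ?V = "\<integral>x. (h x)\<^sup>2 \<partial>P"
  have h1: "integrable P h"
    using h h2 by (rule P.square_integrable_imp_integrable)
  have cross: "integrable ?S (\<lambda>z. h (z i) * h (z j)) \<and>
      (\<integral>z. h (z i) * h (z j) \<partial>?S) = (if i = j then ?V else 0)"
    if ij: "i \<in> {1..m}" "j \<in> {1..m}" for i j
  proof -
    \<comment> \<open>The product rule for \<open>PiM\<close> concerns a product of one factor per
      coordinate. \<open>F\<close> pads \<open>h (z i) * h (z j)\<close> with ones to that shape.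
      For \<open>i = j\<close> both conditions fire at the same coordinate and yield the square of
      \<open>h\<close>. For \<open>i \<noteq> j\<close> the factor at \<open>i\<close> integrates to
      0.\<close>
    define F where "F k x = (if k = i then h x else 1) * (if k = j then h x else 1)" for k x
    have F: "integrable P (F k)" for k
      using h1 h2 by (cases "k = i"; cases "k = j") (auto simp: F_def[abs_def] power2_eq_square)
    have eq: "(\<Prod>k=1..m. F k (z k)) = h (z i) * h (z j)" for z
      using ij by (simp add: F_def prod.distrib)
    have "(\<Prod>k=1..m. integral\<^sup>L P (F k)) = (if i = j then ?V else 0)"
    proof (cases "i = j")
      case True
      then have "integral\<^sup>L P (F k) = (if k = i then ?V else 1)" for k
        by (simp add: F_def[abs_def] power2_eq_square P.prob_space)
      then show ?thesis using True ij by simp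
    next
      case False
      then have "integral\<^sup>L P (F i) = 0"
        by (simp add: F_def[abs_def] mean)
      then show ?thesis using False ij by (auto intro!: prod_zero)
    qed
    then show ?thesis
      using product_integrable_prod[of "{1..m}" F] product_integral_prod[of "{1..m}" F] F
      unfolding eq[symmetric] sample_measure_def by simp
  qed
  have eq: "((1 / real m) * (\<Sum>j=1..m. h (z j)))\<^sup>2
      = (1 / (real m)\<^sup>2) * (\<Sum>i=1..m. \<Sum>j=1..m. h (z i) * h (z j))" for z
    by (simp add: power_mult_distrib power2_eq_square sum_product)
  show "integrable ?S (\<lambda>z. ((1 / real m) * (\<Sum>j=1..m. h (z j)))\<^sup>2)"
    unfolding eq using cross by (intro integrable_mult_right Bochner_Integration.integrable_sum) auto
  have "(\<integral>z. (\<Sum>i=1..m. \<Sum>j=1..m. h (z i) * h (z j)) \<partial>?S)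
      = (\<Sum>i=1..m. (\<integral>z. (\<Sum>j=1..m. h (z i) * h (z j)) \<partial>?S))"
    using cross
    by (intro Bochner_Integration.integral_sum Bochner_Integration.integrable_sum) auto
  also have "\<dots> = (\<Sum>i=1..m. \<Sum>j=1..m. (\<integral>z. h (z i) * h (z j) \<partial>?S))"
    using cross by (intro sum.cong Bochner_Integration.integral_sum) auto
  also have "\<dots> = real m * ?V"
    using cross by simp
  finally show "(\<integral>z. ((1 / real m) * (\<Sum>j=1..m. h (z j)))\<^sup>2 \<partial>?S) = ?V / real m"
    unfolding eq by (simp add: power2_eq_square)
qed

text \<open>Jensen's inequality for the square. It makes the squared error linear in the weights, so
  that integration over x replaces each weight by its mass.\<close>

lemma convex_combination_square_le:
  fixes w :: "'v \<Rightarrow> real"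
  assumes "finite T" "\<And>v. v \<in> T \<Longrightarrow> 0 \<le> w v" "(\<Sum>v\<in>T. w v) = 1"
  shows "(\<Sum>v\<in>T. a v * w v)\<^sup>2 \<le> (\<Sum>v\<in>T. (a v)\<^sup>2 * w v)"
proof -
  have "T \<noteq> {}" using assms(3) by auto
  then have "(\<Sum>v\<in>T. w v *\<^sub>R a v)\<^sup>2 \<le> (\<Sum>v\<in>T. w v * (a v)\<^sup>2)"
    using assms by (intro convex_on_sum[OF _ _ convex_power2]) auto
  then show ?thesis by (simp add: mult.commute)
qed

text \<open>With \<open>r = m powr (1 / (1 + 2 * s))\<close>, both \<open>r powr (- (2 * s))\<close>
  and \<open>r / m\<close> equal the target rate. Taking the integer part costs only a constant
  factor.\<close>

lemma floor_powr_rate: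
  fixes s :: real
  assumes "s > 0" "m \<ge> 1" and N: "N = nat \<lfloor>real m powr (1 / (1 + 2 * s))\<rfloor>"
  shows "N \<ge> 1"
    and "(real N powr (- s))\<^sup>2 \<le> 2 powr (2 * s) * real m powr (- (2 * s / (1 + 2 * s)))"
    and "real N / real m \<le> real m powr (- (2 * s / (1 + 2 * s)))"
proof -
  define r where "r = real m powr (1 / (1 + 2 * s))"
  have r1: "r \<ge> 1" unfolding r_def using assms by (intro ge_one_powr_ge_zero) auto
  then have "\<lfloor>r\<rfloor> \<ge> 1" by simp
  then show N1: "N \<ge> 1" using N r_def by linarith
  have Nle: "real N \<le> r" and Nge: "r < real N + 1"
    using N r1 unfolding r_def[symmetric] by linarith+
  \<comment> \<open>From \<open>r < N + 1\<close> and \<open>1 \<le> N\<close> one gets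
    \<open>r < 2 * N\<close>. The factor 2 is the source of \<open>2 powr (2 * s)\<close>.\<close>
  have half: "r / 2 \<le> real N" using Nge N1 by linarith
  have "(real N powr (- s))\<^sup>2 = real N powr (- (2 * s))"
    using N1 by (simp add: powr_add[symmetric] power2_eq_square)
  also have "\<dots> \<le> (r / 2) powr (- (2 * s))"
    using half r1 assms(1) by (intro powr_mono2') auto
  also have "\<dots> = 2 powr (2 * s) * r powr (- (2 * s))"
    using r1 by (simp add: powr_divide powr_minus field_simps)
  also have "r powr (- (2 * s)) = real m powr (- (2 * s / (1 + 2 * s)))"
    by (simp add: r_def powr_powr)
  finally show "(real N powr (- s))\<^sup>2 \<le> 2 powr (2 * s) * real m powr (- (2 * s / (1 + 2 * s)))" .
  have "1 / (1 + 2 * s) - 1 = - (2 * s / (1 + 2 * s))"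
    using assms(1) by (simp add: field_simps)
  then have "r / real m = real m powr (- (2 * s / (1 + 2 * s)))"
    using powr_diff[of "real m" "1 / (1 + 2 * s)" 1] assms(2) by (simp add: r_def)
  then show "real N / real m \<le> real m powr (- (2 * s / (1 + 2 * s)))"
    using Nle divide_right_mono[OF Nle, of "real m"] by simp
qed

text \<open>The key identity for one fixed sample, without probability: the random denominator is
  never divided by, only multiplied away.\<close>

lemma emp_coeff_deviation:
  assumes "\<And>j. j \<in> {1..m} \<Longrightarrow> \<bar>snd (z j)\<bar> \<le> A" "\<And>j. j \<in> {1..m} \<Longrightarrow> 0 \<le> g (fst (z j))"
  shows abs_emp_coeff_le: "0 \<le> A \<Longrightarrow> \<bar>emp_coeff m z g\<bar> \<le> A"
    and "\<bar>c\<bar> \<le> A \<Longrightarrow> (r * (emp_coeff m z g - c))\<^sup>2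
      \<le> 2 * (emp_alpha m z g - c * emp_mass m z g)\<^sup>2 + 8 * A\<^sup>2 * (emp_mass m z g - r)\<^sup>2"
proof -
  let ?k = "emp_coeff m z g" and ?q = "emp_mass m z g" and ?a = "emp_alpha m z g"
  have q0: "0 \<le> ?q"
    unfolding emp_mass_def using assms(2) by (intro mult_nonneg_nonneg sum_nonneg) auto
  have "\<bar>\<Sum>j=1..m. snd (z j) * g (fst (z j))\<bar> \<le> (\<Sum>j=1..m. A * g (fst (z j)))"
    using assms by (intro order_trans[OF sum_abs] sum_mono) (auto simp: abs_mult intro!: mult_right_mono)
  then have a: "\<bar>?a\<bar> \<le> A * ?q"
    unfolding emp_alpha_def emp_mass_def
    by (simp add: abs_mult sum_distrib_left[symmetric] divide_right_mono)
  \<comment> \<open>This also covers an empty denominator: if \<open>?q = 0\<close>, the bound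
    \<open>a\<close> forces \<open>?a = 0\<close>, in agreement with the default value 0 of the
    coefficient.\<close>
  have kq: "?k * ?q = ?a"
    using a by (auto simp: emp_coeff_def)
  show k: "\<bar>?k\<bar> \<le> A" if "0 \<le> A"
    using a q0 that by (auto simp: emp_coeff_def abs_divide divide_le_eq)
  assume c: "\<bar>c\<bar> \<le> A"
  have "r * (?k - c) = (?a - c * ?q) + (r - ?q) * (?k - c)"
    by (simp add: kq[symmetric] algebra_simps)
  then have "(r * (?k - c))\<^sup>2 = ((?a - c * ?q) + (r - ?q) * (?k - c))\<^sup>2"
    by simp
  also have "\<dots> \<le> 2 * (?a - c * ?q)\<^sup>2 + 2 * ((r - ?q) * (?k - c))\<^sup>2"
    using sum_squares_bound[of "?a - c * ?q" "(r - ?q) * (?k - c)"] by (simp add: power2_sum)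
  \<comment> \<open>Both coefficients lie in \<open>{-A..A}\<close>, hence differ by at most
    \<open>2 * A\<close>. Squared and doubled, this gives the constant
    \<open>8 * A\<^sup>2\<close>.\<close>
  also have "((r - ?q) * (?k - c))\<^sup>2 \<le> (r - ?q)\<^sup>2 * (2 * A)\<^sup>2"
  proof -
    have "\<bar>?k - c\<bar> \<le> \<bar>2 * A\<bar>" using c k by linarith
    then have "(?k - c)\<^sup>2 \<le> (2 * A)\<^sup>2" by (simp only: abs_le_square_iff)
    then show ?thesis unfolding power_mult_distrib[of "r - ?q"] by (rule mult_left_mono) simp
  qed
  finally show "(r * (?k - c))\<^sup>2 \<le> 2 * (?a - c * ?q)\<^sup>2 + 8 * A\<^sup>2 * (?q - r)\<^sup>2"
    by (simp add: power2_commute[of r] algebra_simps)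
qed

section \<open>The joint law, its marginal and the conditional kernel\<close>

locale bounded_regression =
  fixes X :: "'a::second_countable_topology set" and A :: real
    and \<rho> :: "('a \<times> real) measure" and \<kappa> :: "'a \<Rightarrow> real measure"
  assumes probability: "borel_probability_on (X \<times> {-A..A}) \<rho>"
    and disintegration: "disintegration X {-A..A} \<rho> \<kappa>"
begin

abbreviation \<mu> :: "'a measure" where "\<mu> \<equiv> marginal X \<rho>"

sublocale prob_space \<rho>
  using probability by (simp add: borel_probability_on_def)

lemma sets_joint: "sets \<rho> = sets (restrict_space borel (X \<times> {-A..A}))"
  using probability by (simp add: borel_probability_on_def)

lemma space_joint: "space \<rho> = X \<times> {-A..A}"
  using sets_eq_imp_space_eq[OF sets_joint] by (simp add: space_restrict_space)

text \<open>A probability space is nonempty, so the interval \<open>{-A..A}\<close> contains a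
  point.\<close>

lemma bound_nonneg: "0 \<le> A"
  using not_empty by (auto simp: space_joint)

lemma sets_marginal: "sets \<mu> = sets (restrict_space borel X)"
  by (simp add: marginal_def)

lemma space_marginal: "space \<mu> = X"
  by (simp add: marginal_def space_restrict_space)

text \<open>Second countability enters through \<open>borel_prod\<close>: the Borel sets of the
  product space form the product sigma-algebra, for which projections are measurable.\<close>

lemma measurable_fst_marginal [measurable]: "fst \<in> \<rho> \<rightarrow>\<^sub>M \<mu>"
proof -
  have "fst \<in> restrict_space borel (X \<times> {-A..A}) \<rightarrow>\<^sub>M borel"
    by (rule measurable_restrict_space1) (simp add: borel_prod[symmetric])
  then have "fst \<in> \<rho> \<rightarrow>\<^sub>M restrict_space borel X"
    by (intro measurable_restrict_space2) (auto simp: space_joint sets_joint cong: measurable_cong_sets)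
  then show ?thesis by (simp add: sets_marginal cong: measurable_cong_sets)
qed

lemma borel_measurable_snd_joint [measurable]: "snd \<in> borel_measurable \<rho>"
proof -
  have "snd \<in> restrict_space borel (X \<times> {-A..A}) \<rightarrow>\<^sub>M borel"
    by (rule measurable_restrict_space1) (simp add: borel_prod[symmetric])
  then show ?thesis by (simp add: sets_joint cong: measurable_cong_sets)
qed

text \<open>With \<open>\<mu>\<close> itself as the target space, the rules for \<open>distr\<close>
  produce statements about \<open>\<mu>\<close> directly.\<close>

lemma marginal_eq: "\<mu> = distr \<rho> \<mu> fst"
  by (simp add: marginal_def cong: distr_cong)

sublocale marginal: prob_space \<mu>
  by (subst marginal_eq) (rule prob_space_distr, measurable)

lemma integral_marginal:
  fixes g :: "'a \<Rightarrow> real"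
  assumes "g \<in> borel_measurable \<mu>"
  shows "(\<integral>p. g (fst p) \<partial>\<rho>) = (\<integral>x. g x \<partial>\<mu>)"
  using integral_distr[OF measurable_fst_marginal assms] by (simp add: marginal_eq[symmetric])

lemma measurable_kernel: "\<kappa> \<in> \<mu> \<rightarrow>\<^sub>M prob_algebra (restrict_space borel {-A..A})"
  using disintegration by (simp add: disintegration_def sets_marginal cong: measurable_cong_sets)

lemma
  assumes "x \<in> X"
  shows sets_kernel_at: "sets (\<kappa> x) = sets (restrict_space borel {-A..A})"
    and space_kernel_at: "space (\<kappa> x) = {-A..A}"
    and prob_space_kernel_at: "prob_space (\<kappa> x)"
proof -
  have \<kappa>: "sets (\<kappa> x) = sets (restrict_space borel {-A..A}) \<and> prob_space (\<kappa> x)"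
    using measurable_space[OF measurable_kernel, of x] assms
    by (simp add: space_prob_algebra space_marginal)
  then show "sets (\<kappa> x) = sets (restrict_space borel {-A..A})" "prob_space (\<kappa> x)" by auto
  show "space (\<kappa> x) = {-A..A}"
    using sets_eq_imp_space_eq[OF \<kappa>[THEN conjunct1]] by (simp add: space_restrict_space)
qed

text \<open>Lifts the disintegration from sets to bounded functions by recognising
  \<open>\<rho>\<close> as a monadic \<open>bind\<close>, for which iterated integration of bounded
  functions is available.\<close>

lemma integral_joint:
  fixes h :: "'a \<times> real \<Rightarrow> real"
  assumes h: "h \<in> borel_measurable \<rho>" and bound: "\<And>p. p \<in> space \<rho> \<Longrightarrow> \<bar>h p\<bar> \<le> B"
  shows "(\<integral>p. h p \<partial>\<rho>) = (\<integral>x. (\<integral>y. h (x, y) \<partial>\<kappa> x) \<partial>\<mu>)"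
proof -
  let ?Y = "restrict_space borel {-A..A}"
  have pair: "(\<lambda>(x, y). (x, y)) \<in> \<mu> \<Otimes>\<^sub>M ?Y \<rightarrow>\<^sub>M \<rho>"
  proof -
    have "(\<lambda>x. x) \<in> \<mu> \<rightarrow>\<^sub>M borel"
      by (simp add: sets_marginal measurable_restrict_space1 cong: measurable_cong_sets)
    then have "(\<lambda>p. (fst p, snd p)) \<in> \<mu> \<Otimes>\<^sub>M ?Y \<rightarrow>\<^sub>M borel \<Otimes>\<^sub>M borel"
      by (intro measurable_Pair measurable_compose[OF measurable_fst]
          measurable_compose[OF measurable_snd]) (auto intro: measurable_restrict_space1)
    then have "(\<lambda>(x, y). (x, y)) \<in> \<mu> \<Otimes>\<^sub>M ?Y \<rightarrow>\<^sub>M restrict_space borel (X \<times> {-A..A})"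
      by (intro measurable_restrict_space2)
        (auto simp: space_pair_measure space_restrict_space space_marginal borel_prod split_beta')
    then show ?thesis by (simp add: sets_joint cong: measurable_cong_sets)
  qed
  have Pair: "Pair x \<in> \<kappa> x \<rightarrow>\<^sub>M \<rho>" if "x \<in> X" for x
    using measurable_compose[OF measurable_Pair1' pair, of x] that
    by (simp add: space_marginal sets_kernel_at cong: measurable_cong_sets)
  \<comment> \<open>\<open>L x\<close> is the conditional law \<open>\<kappa> x\<close> transported
    to the fibre over \<open>x\<close>, now a measure on the joint space. Its mass on
    \<open>S\<close> is the mass that \<open>\<kappa> x\<close> gives to the section of
    \<open>S\<close> at \<open>x\<close>, which is the integrand in the disintegration.\<close>
  define L where "L x = distr (\<kappa> x) \<rho> (Pair x)" for x
  have "L \<in> \<mu> \<rightarrow>\<^sub>M prob_algebra \<rho>"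
    unfolding L_def by (rule measurable_distr_prob_space2[OF measurable_kernel pair])
  then have L: "L \<in> \<mu> \<rightarrow>\<^sub>M subprob_algebra \<rho>"
    by (rule measurable_prob_algebraD)
  have sets_L: "sets (L x) = sets \<rho>" for x by (simp add: L_def)
  have "\<rho> = bind \<mu> L"
  proof (rule measure_eqI)
    show "sets \<rho> = sets (bind \<mu> L)"
      using sets_bind[of \<mu> L \<rho>] sets_L marginal.not_empty by simp
  next
    fix S assume S: "S \<in> sets \<rho>"
    have "emeasure \<rho> S = (\<integral>\<^sup>+x. emeasure (\<kappa> x) {y \<in> {-A..A}. (x, y) \<in> S} \<partial>\<mu>)"
      using disintegration S by (simp add: disintegration_def)
    also have "\<dots> = (\<integral>\<^sup>+x. emeasure (L x) S \<partial>\<mu>)"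
    proof (rule nn_integral_cong)
      fix x assume "x \<in> space \<mu>"
      then have x: "x \<in> X" by (simp add: space_marginal)
      have "emeasure (L x) S = emeasure (\<kappa> x) (Pair x -` S \<inter> space (\<kappa> x))"
        unfolding L_def by (intro emeasure_distr Pair x S)
      also have "Pair x -` S \<inter> space (\<kappa> x) = {y \<in> {-A..A}. (x, y) \<in> S}"
        unfolding space_kernel_at[OF x] by blast
      finally show "emeasure (\<kappa> x) {y \<in> {-A..A}. (x, y) \<in> S} = emeasure (L x) S" ..
    qed
    also have "\<dots> = emeasure (bind \<mu> L) S"
      by (rule emeasure_bind[OF marginal.not_empty L S, symmetric])
    finally show "emeasure \<rho> S = emeasure (bind \<mu> L) S" .
  qed
  then have "(\<integral>p. h p \<partial>\<rho>) = integral\<^sup>L (bind \<mu> L) h" by (rule arg_cong)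
  also have "\<dots> = (\<integral>x. integral\<^sup>L (L x) h \<partial>\<mu>)"
  proof (rule integral_bind[OF h bound L marginal.finite_measure_axioms])
    show "AE x in \<mu>. emeasure (L x) (space (L x)) \<le> ennreal 1"
      using subprob_space.emeasure_space_le_1[OF subprob_space_kernel[OF L]]
      by (intro AE_I2) simp
  qed
  also have "\<dots> = (\<integral>x. (\<integral>y. h (x, y) \<partial>\<kappa> x) \<partial>\<mu>)"
    by (rule Bochner_Integration.integral_cong)
      (auto simp: L_def space_marginal intro!: integral_distr Pair h)
  finally show ?thesis .
qed

lemma borel_measurable_regression [measurable]: "regression \<kappa> \<in> borel_measurable \<mu>"
  unfolding regression_def
  by (rule measurable_compose[OF measurable_prob_algebraD[OF measurable_kernel]
      integral_measurable_subprob_algebra]) (simp add: measurable_restrict_space1)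

lemma abs_regression_le:
  assumes "x \<in> X"
  shows "\<bar>regression \<kappa> x\<bar> \<le> A"
proof -
  interpret \<kappa>: prob_space "\<kappa> x" by (rule prob_space_kernel_at[OF assms])
  have int: "integrable (\<kappa> x) (\<lambda>y. y)"
    by (rule \<kappa>.integrable_const_bound[where B = A])
      (auto simp: space_kernel_at assms sets_kernel_at measurable_restrict_space1
        intro!: AE_I2 cong: measurable_cong_sets)
  have "(\<integral>y. y \<partial>\<kappa> x) \<le> (\<integral>y. A \<partial>\<kappa> x)" "(\<integral>y. - A \<partial>\<kappa> x) \<le> (\<integral>y. y \<partial>\<kappa> x)"
    using int by (intro integral_mono; simp add: space_kernel_at assms)+
  then show ?thesis by (simp add: regression_def \<kappa>.prob_space)
qed

section \<open>The error of a single coefficient\<close>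

context
  fixes g :: "'a \<Rightarrow> real"
  assumes g [measurable]: "g \<in> borel_measurable \<mu>" and g01: "\<And>x. x \<in> X \<Longrightarrow> 0 \<le> g x \<and> g x \<le> 1"
begin

lemma integrable_weight: "integrable \<rho> (\<lambda>p. g (fst p))"
  by (rule integrable_const_bound[where B = 1]) (auto simp: space_joint g01)

lemma abs_snd_mult_weight_le:
  "p \<in> space \<rho> \<Longrightarrow> \<bar>snd p * g (fst p)\<bar> \<le> A * g (fst p)"
  by (auto simp: space_joint abs_mult g01 intro!: mult_right_mono)

lemma integrable_snd_mult_weight: "integrable \<rho> (\<lambda>p. snd p * g (fst p))"
proof (rule Bochner_Integration.integrable_bound)
  show "integrable \<rho> (\<lambda>p. A * g (fst p))" using integrable_weight by simp
  show "AE p in \<rho>. norm (snd p * g (fst p)) \<le> norm (A * g (fst p))"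
    using abs_snd_mult_weight_le by (intro AE_I2) force
qed measurable

text \<open>Hence \<open>emp_alpha\<close> is an unbiased estimate of the numerator of
  \<open>Q_coeff\<close>: the regression function averages y over each fibre, and \<open>g\<close>
  is constant on fibres.\<close>

lemma integral_regression_mult_weight:
  "(\<integral>x. regression \<kappa> x * g x \<partial>\<mu>) = (\<integral>p. snd p * g (fst p) \<partial>\<rho>)"
proof -
  have "\<bar>snd p * g (fst p)\<bar> \<le> A" if "p \<in> space \<rho>" for p
    using abs_snd_mult_weight_le[OF that] g01[of "fst p"] that bound_nonneg
      mult_left_le[of "g (fst p)" A] by (auto simp: space_joint)
  from integral_joint[OF _ this] show ?thesis
    by (simp add: regression_def)
qed

text \<open>For positive mass the coefficient is an average of y with weight \<open>g\<close>, and y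
  lies in \<open>{-A..A}\<close>. The default value 0 is covered by
  \<open>bound_nonneg\<close>.\<close>

lemma abs_Q_coeff_le: "\<bar>Q_coeff \<mu> g (regression \<kappa>)\<bar> \<le> A"
proof -
  have "\<bar>\<integral>p. snd p * g (fst p) \<partial>\<rho>\<bar> \<le> (\<integral>p. \<bar>snd p * g (fst p)\<bar> \<partial>\<rho>)"
    by (rule integral_abs_bound)
  also have "\<dots> \<le> (\<integral>p. A * g (fst p) \<partial>\<rho>)"
    using abs_snd_mult_weight_le integrable_weight integrable_snd_mult_weight
    by (intro integral_mono) auto
  also have "\<dots> = A * (\<integral>x. g x \<partial>\<mu>)" by (simp add: integral_marginal)
  finally have *: "\<bar>\<integral>x. regression \<kappa> x * g x \<partial>\<mu>\<bar> \<le> A * (\<integral>x. g x \<partial>\<mu>)"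
    by (simp add: integral_regression_mult_weight)
  have "0 \<le> (\<integral>x. g x \<partial>\<mu>)"
    by (rule Bochner_Integration.integral_nonneg_AE) (auto simp: space_marginal g01)
  with * bound_nonneg show ?thesis
    by (auto simp: Q_coeff_def abs_divide divide_le_eq)
qed

text \<open>Squaring the key identity bounds \<open>r\<^sup>2\<close> times the mean square error by
  \<open>16 * A\<^sup>2 * r / m\<close>, and one factor \<open>r\<close> cancels. The remaining
  \<open>r\<close> is exactly the weight that this coefficient carries in the risk after integration
  over x.\<close>

lemma
  assumes m: "m \<ge> 1"
  defines "c \<equiv> Q_coeff \<mu> g (regression \<kappa>)" and "r \<equiv> \<integral>x. g x \<partial>\<mu>"
  shows integrable_coeff_error:
      "integrable (sample_measure m \<rho>) (\<lambda>z. (emp_coeff m z g - c)\<^sup>2)" (is ?int)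
    and expected_coeff_error_le:
      "r * (\<integral>z. (emp_coeff m z g - c)\<^sup>2 \<partial>sample_measure m \<rho>) \<le> 16 * A\<^sup>2 / real m" (is ?le)
proof -
  let ?S = "sample_measure m \<rho>"
  interpret S: prob_space ?S
    unfolding sample_measure_def by (rule prob_space_PiM) unfold_locales
  have c: "\<bar>c\<bar> \<le> A" unfolding c_def by (rule abs_Q_coeff_le)
  have z: "z j \<in> space \<rho>" if "z \<in> space ?S" "j \<in> {1..m}" for z j
    using that by (auto simp: sample_measure_def space_PiM)
  have z': "\<bar>snd (z j)\<bar> \<le> A" "0 \<le> g (fst (z j))" if "z \<in> space ?S" "j \<in> {1..m}" for z j
    using z[OF that] g01 by (auto simp: space_joint mem_Times_iff)
  have comp [measurable]: "(\<lambda>z. z j) \<in> ?S \<rightarrow>\<^sub>M \<rho>" if "j \<in> {1..m}" for j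
    unfolding sample_measure_def using that by (rule measurable_component_singleton)
  have [measurable]: "(\<lambda>z. emp_alpha m z g) \<in> borel_measurable ?S"
      "(\<lambda>z. emp_mass m z g) \<in> borel_measurable ?S"
    unfolding emp_alpha_def emp_mass_def
    by (intro borel_measurable_times borel_measurable_const borel_measurable_sum
        measurable_compose[OF comp]; measurable)+
  have [measurable]: "(\<lambda>z. emp_coeff m z g) \<in> borel_measurable ?S"
    unfolding emp_coeff_def by measurable
  show int: ?int
  proof (rule S.integrable_const_bound[where B = "(2 * A)\<^sup>2"])
    have "\<bar>emp_coeff m z g - c\<bar> \<le> \<bar>2 * A\<bar>" if "z \<in> space ?S" for z
      using abs_emp_coeff_le[of m z A g] z'[OF that] bound_nonneg c by fastforce
    then show "AE z in ?S. norm ((emp_coeff m z g - c)\<^sup>2) \<le> (2 * A)\<^sup>2"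
      unfolding abs_le_square_iff by (intro AE_I2) simp
  qed measurable
  \<comment> \<open>\<open>h1\<close> and \<open>h2\<close> are the summands whose sample means are
    \<open>emp_alpha - c * emp_mass\<close> and \<open>emp_mass - r\<close>.\<close>
  define h1 where "h1 p = (snd p - c) * g (fst p)" for p
  define h2 where "h2 p = g (fst p) - r" for p :: "'a \<times> real"
  have h1 [measurable]: "h1 \<in> borel_measurable \<rho>" and h2 [measurable]: "h2 \<in> borel_measurable \<rho>"
    unfolding h1_def h2_def by measurable
  have r: "(\<integral>p. g (fst p) \<partial>\<rho>) = r" by (simp add: r_def integral_marginal)
  have r0: "0 \<le> r"
    unfolding r_def by (rule Bochner_Integration.integral_nonneg_AE) (auto simp: space_marginal g01)
  \<comment> \<open>Since \<open>g\<close> takes values in the unit interval, its square is at most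
    \<open>g\<close>. This makes both variances proportional to \<open>r\<close> rather than merely
    bounded, which is what allows a factor \<open>r\<close> to be cancelled.\<close>
  have gg: "(g (fst p))\<^sup>2 \<le> g (fst p)" if "p \<in> space \<rho>" for p
    using g01[of "fst p"] that by (auto simp: space_joint power2_eq_square mult_left_le)
  have int_g2: "integrable \<rho> (\<lambda>p. (g (fst p))\<^sup>2)"
    by (rule Bochner_Integration.integrable_bound[OF integrable_weight]) (use gg in \<open>force intro!: AE_I2\<close>)+
  have h1_le: "(h1 p)\<^sup>2 \<le> 4 * A\<^sup>2 * g (fst p)" if "p \<in> space \<rho>" for p
  proof -
    have "\<bar>snd p - c\<bar> \<le> \<bar>2 * A\<bar>" using that c by (auto simp: space_joint)
    then have "(snd p - c)\<^sup>2 \<le> (2 * A)\<^sup>2" by (simp only: abs_le_square_iff)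
    then have "(snd p - c)\<^sup>2 * (g (fst p))\<^sup>2 \<le> (2 * A)\<^sup>2 * g (fst p)"
      using gg[OF that] by (intro mult_mono) auto
    then show ?thesis by (simp add: h1_def power_mult_distrib)
  qed
  have int_h1: "integrable \<rho> (\<lambda>p. (h1 p)\<^sup>2)"
  proof (rule Bochner_Integration.integrable_bound)
    show "integrable \<rho> (\<lambda>p. 4 * A\<^sup>2 * g (fst p))" using integrable_weight by simp
    show "AE p in \<rho>. norm ((h1 p)\<^sup>2) \<le> norm (4 * A\<^sup>2 * g (fst p))"
      using h1_le by (intro AE_I2) force
  qed measurable
  have h2_eq: "(h2 p)\<^sup>2 = (g (fst p))\<^sup>2 - 2 * r * g (fst p) + r\<^sup>2" for p
    by (simp add: h2_def power2_diff)
  have int_h2: "integrable \<rho> (\<lambda>p. (h2 p)\<^sup>2)"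
    unfolding h2_eq using int_g2 integrable_weight by simp
  have var1: "(\<integral>p. (h1 p)\<^sup>2 \<partial>\<rho>) \<le> 4 * A\<^sup>2 * r"
    using integral_mono[OF int_h1 _ h1_le] integrable_weight by (simp add: r)
  have "(\<integral>p. (g (fst p))\<^sup>2 \<partial>\<rho>) \<le> r"
    using integral_mono[OF int_g2 integrable_weight gg] by (simp add: r)
  moreover have "(\<integral>p. (h2 p)\<^sup>2 \<partial>\<rho>) = (\<integral>p. (g (fst p))\<^sup>2 \<partial>\<rho>) - r\<^sup>2"
    unfolding h2_eq using int_g2 integrable_weight
    by (simp add: r prob_space power2_eq_square)
  ultimately have var2: "(\<integral>p. (h2 p)\<^sup>2 \<partial>\<rho>) \<le> r" by (smt (verit) zero_le_power2)
  have mean2: "(\<integral>p. h2 p \<partial>\<rho>) = 0"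
    unfolding h2_def using integrable_weight by (simp add: r prob_space)
  show ?le
  proof (cases "r = 0")
    case True
    then show ?thesis by simp
  next
    case False
    \<comment> \<open>Only for \<open>r \<noteq> 0\<close> is \<open>c\<close> a genuine quotient;
      this equation is what centres \<open>h1\<close>.\<close>
    have cr: "c * r = (\<integral>p. snd p * g (fst p) \<partial>\<rho>)"
      using False unfolding c_def r_def by (simp add: Q_coeff_def integral_regression_mult_weight)
    have mean1: "(\<integral>p. h1 p \<partial>\<rho>) = 0"
      unfolding h1_def left_diff_distrib
      using integrable_weight integrable_snd_mult_weight by (simp add: r cr)
    have D: "emp_alpha m z g - c * emp_mass m z g = (1 / real m) * (\<Sum>j=1..m. h1 (z j))" for z
      by (simp add: emp_alpha_def emp_mass_def h1_def left_diff_distrib sum_subtractf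
          sum_distrib_left[symmetric] mult.assoc diff_divide_distrib)
    have E: "emp_mass m z g - r = (1 / real m) * (\<Sum>j=1..m. h2 (z j))" for z
      using m by (simp add: emp_mass_def h2_def sum_subtractf diff_divide_distrib)
    note m1 = second_moment_sample_mean[OF prob_space_axioms h1 int_h1 mean1, of m]
      and m2 = second_moment_sample_mean[OF prob_space_axioms h2 int_h2 mean2, of m]
    have "r\<^sup>2 * (\<integral>z. (emp_coeff m z g - c)\<^sup>2 \<partial>?S) = (\<integral>z. (r * (emp_coeff m z g - c))\<^sup>2 \<partial>?S)"
      by (simp add: power_mult_distrib)
    also have "\<dots> \<le> (\<integral>z. 2 * ((1 / real m) * (\<Sum>j=1..m. h1 (z j)))\<^sup>2
        + 8 * A\<^sup>2 * ((1 / real m) * (\<Sum>j=1..m. h2 (z j)))\<^sup>2 \<partial>?S)"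
    proof (rule integral_mono)
      show "integrable ?S (\<lambda>z. (r * (emp_coeff m z g - c))\<^sup>2)"
        using int by (simp add: power_mult_distrib)
      show "integrable ?S (\<lambda>z. 2 * ((1 / real m) * (\<Sum>j=1..m. h1 (z j)))\<^sup>2
          + 8 * A\<^sup>2 * ((1 / real m) * (\<Sum>j=1..m. h2 (z j)))\<^sup>2)"
        by (intro Bochner_Integration.integrable_add integrable_mult_right m1(1) m2(1))
    next
      fix z assume "z \<in> space ?S"
      then show "(r * (emp_coeff m z g - c))\<^sup>2 \<le> 2 * ((1 / real m) * (\<Sum>j=1..m. h1 (z j)))\<^sup>2
          + 8 * A\<^sup>2 * ((1 / real m) * (\<Sum>j=1..m. h2 (z j)))\<^sup>2"
        unfolding D[symmetric] E[symmetric] using z' c by (intro emp_coeff_deviation(2)) auto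
    qed
    also have "\<dots> = 2 * ((\<integral>p. (h1 p)\<^sup>2 \<partial>\<rho>) / real m) + 8 * A\<^sup>2 * ((\<integral>p. (h2 p)\<^sup>2 \<partial>\<rho>) / real m)"
      by (subst Bochner_Integration.integral_add)
        (simp_all only: integral_mult_right_zero m1 m2 integrable_mult_right)
    \<comment> \<open>The two variance bounds contribute \<open>8 * A\<^sup>2 * r / m\<close> each,
      hence the 16.\<close>
    also have "\<dots> \<le> 2 * ((4 * A\<^sup>2 * r) / real m) + 8 * A\<^sup>2 * (r / real m)"
      using var1 var2 by (intro add_mono mult_left_mono divide_right_mono) auto
    also have "\<dots> = r * (16 * A\<^sup>2 / real m)" by (simp add: field_simps)
    finally have "r * (r * (\<integral>z. (emp_coeff m z g - c)\<^sup>2 \<partial>?S)) \<le> r * (16 * A\<^sup>2 / real m)"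
      by (simp add: power2_eq_square mult.assoc)
    then show ?thesis using False r0 by (simp only: mult_le_cancel_left)
  qed
qed

end

section \<open>Risk for a fixed admissible family\<close>

text \<open>Splits the error at \<open>Q_op\<close> into bias and stochastic part, with a factor 2
  for squaring the sum. After Jensen each stochastic term is a product of a function of z and a
  function of x, so the two integrations are carried out separately, without Fubini. The constant is
  2 times 16.\<close>

lemma expected_risk_le:
  assumes adm: "admissible \<mu> T M" and m: "m \<ge> 1"
  shows "(\<integral>z. (L2_norm \<mu> (\<lambda>x. regression \<kappa> x - estimator T M m z x))\<^sup>2 \<partial>sample_measure m \<rho>)
    \<le> 2 * (L2_norm \<mu> (\<lambda>x. regression \<kappa> x - Q_op \<mu> T M (regression \<kappa>) x))\<^sup>2
      + 32 * A\<^sup>2 * (real (card T) / real m)"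
proof -
  let ?S = "sample_measure m \<rho>" and ?f = "regression \<kappa>"
  define c where "c v = Q_coeff \<mu> (M v) ?f" for v
  define r where "r v = (\<integral>x. M v x \<partial>\<mu>)" for v
  define q where "q z v = (emp_coeff m z (M v) - c v)\<^sup>2" for z v
  define b where "b = (L2_norm \<mu> (\<lambda>x. ?f x - Q_op \<mu> T M ?f x))\<^sup>2"
  interpret S: prob_space ?S
    unfolding sample_measure_def by (rule prob_space_PiM) unfold_locales
  have fin: "finite T" and M: "\<And>v. v \<in> T \<Longrightarrow> M v \<in> borel_measurable \<mu>"
    and M01: "\<And>v x. v \<in> T \<Longrightarrow> x \<in> X \<Longrightarrow> 0 \<le> M v x \<and> M v x \<le> 1"
    and M1: "\<And>x. x \<in> X \<Longrightarrow> (\<Sum>v\<in>T. M v x) = 1"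
    using adm by (auto simp: admissible_def space_marginal)
  have int_M: "integrable \<mu> (M v)" if "v \<in> T" for v
    using M[OF that] M01[OF that]
    by (intro marginal.integrable_const_bound[where B = 1]) (auto simp: space_marginal)
  have c: "\<bar>c v\<bar> \<le> A" if "v \<in> T" for v
    unfolding c_def using abs_Q_coeff_le[OF M M01] that by blast
  have Q: "Q_op \<mu> T M ?f x = (\<Sum>v\<in>T. c v * M v x)" for x
    by (simp add: Q_op_def c_def)
  have [measurable]: "Q_op \<mu> T M ?f \<in> borel_measurable \<mu>"
    unfolding Q[abs_def] using M by measurable
  have Q_le: "\<bar>Q_op \<mu> T M ?f x\<bar> \<le> A" if "x \<in> X" for x
  proof -
    have "\<bar>Q_op \<mu> T M ?f x\<bar> \<le> (\<Sum>v\<in>T. A * M v x)"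
      unfolding Q using M01 c that
      by (intro order_trans[OF sum_abs] sum_mono) (auto simp: abs_mult intro!: mult_right_mono)
    also have "\<dots> = A" using M1[OF that] by (simp add: sum_distrib_left[symmetric])
    finally show ?thesis .
  qed
  have int_bias: "integrable \<mu> (\<lambda>x. (?f x - Q_op \<mu> T M ?f x)\<^sup>2)"
  proof (rule marginal.integrable_const_bound[where B = "(2 * A)\<^sup>2"])
    have "\<bar>?f x - Q_op \<mu> T M ?f x\<bar> \<le> \<bar>2 * A\<bar>" if "x \<in> X" for x
      using abs_regression_le[OF that] Q_le[OF that] by linarith
    then show "AE x in \<mu>. norm ((?f x - Q_op \<mu> T M ?f x)\<^sup>2) \<le> (2 * A)\<^sup>2"
      unfolding abs_le_square_iff by (intro AE_I2) (simp add: space_marginal)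
  qed measurable
  have L2_sq: "(L2_norm \<mu> u)\<^sup>2 = (\<integral>x. (u x)\<^sup>2 \<partial>\<mu>)" for u
    by (simp add: L2_norm_def)
  \<comment> \<open>The bound holds for every \<open>z\<close>: Jensen's inequality uses only the
    weights \<open>M v\<close>, while the sample enters through the numbers
    \<open>q z v\<close>.\<close>
  have risk: "(L2_norm \<mu> (\<lambda>x. ?f x - estimator T M m z x))\<^sup>2 \<le> 2 * b + 2 * (\<Sum>v\<in>T. r v * q z v)" for z
  proof -
    have "(\<integral>x. (?f x - estimator T M m z x)\<^sup>2 \<partial>\<mu>)
        \<le> (\<integral>x. 2 * (?f x - Q_op \<mu> T M ?f x)\<^sup>2 + 2 * (\<Sum>v\<in>T. q z v * M v x) \<partial>\<mu>)"
    proof (rule integral_mono')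
      show "integrable \<mu> (\<lambda>x. 2 * (?f x - Q_op \<mu> T M ?f x)\<^sup>2 + 2 * (\<Sum>v\<in>T. q z v * M v x))"
        using int_bias int_M by auto
    next
      fix x assume "x \<in> space \<mu>"
      then have x: "x \<in> X" by (simp add: space_marginal)
      let ?e = "Q_op \<mu> T M ?f x - estimator T M m z x"
      have "?e = (\<Sum>v\<in>T. (c v - emp_coeff m z (M v)) * M v x)"
        by (simp add: Q estimator_def left_diff_distrib sum_subtractf)
      then have "?e\<^sup>2 \<le> (\<Sum>v\<in>T. q z v * M v x)"
        using convex_combination_square_le[OF fin, of "\<lambda>v. M v x" "\<lambda>v. c v - emp_coeff m z (M v)"]
          M01 M1 x by (simp add: q_def power2_commute)
      moreover have "(?f x - estimator T M m z x)\<^sup>2 \<le> 2 * (?f x - Q_op \<mu> T M ?f x)\<^sup>2 + 2 * ?e\<^sup>2"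
        using sum_squares_bound[of "?f x - Q_op \<mu> T M ?f x" ?e]
          power2_sum[of "?f x - Q_op \<mu> T M ?f x" ?e] by simp
      ultimately show "(?f x - estimator T M m z x)\<^sup>2
          \<le> 2 * (?f x - Q_op \<mu> T M ?f x)\<^sup>2 + 2 * (\<Sum>v\<in>T. q z v * M v x)" by linarith
      show "0 \<le> 2 * (?f x - Q_op \<mu> T M ?f x)\<^sup>2 + 2 * (\<Sum>v\<in>T. q z v * M v x)"
        using M01 x by (intro add_nonneg_nonneg mult_nonneg_nonneg sum_nonneg) (auto simp: q_def)
    qed
    also have "\<dots> = 2 * b + 2 * (\<Sum>v\<in>T. r v * q z v)"
      using int_bias int_M by (simp add: b_def L2_sq r_def mult.commute)
    finally show ?thesis by (simp add: L2_sq)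
  qed
  have int_q: "integrable ?S (\<lambda>z. q z v)" if "v \<in> T" for v
    unfolding q_def c_def using M M01 that by (intro integrable_coeff_error m) auto
  have "(\<integral>z. (L2_norm \<mu> (\<lambda>x. ?f x - estimator T M m z x))\<^sup>2 \<partial>?S)
      \<le> (\<integral>z. 2 * b + 2 * (\<Sum>v\<in>T. r v * q z v) \<partial>?S)"
  \<comment> \<open>\<open>integral_mono'\<close> asks for an integrable, nonnegative majorant. If
    the risk were not integrable in \<open>z\<close>, its Bochner integral would be 0 and the bound
    would still hold.\<close>
  proof (rule integral_mono')
    show "integrable ?S (\<lambda>z. 2 * b + 2 * (\<Sum>v\<in>T. r v * q z v))"
      using int_q by auto
    show "0 \<le> 2 * b + 2 * (\<Sum>v\<in>T. r v * q z v)" for z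
      using order_trans[OF zero_le_power2 risk] .
  qed (rule risk)
  also have "\<dots> = 2 * b + 2 * (\<Sum>v\<in>T. r v * (\<integral>z. q z v \<partial>?S))"
    using int_q by (simp add: S.prob_space)
  also have "(\<Sum>v\<in>T. r v * (\<integral>z. q z v \<partial>?S)) \<le> (\<Sum>v\<in>T. 16 * A\<^sup>2 / real m)"
    unfolding q_def c_def r_def using M M01
    by (intro sum_mono expected_coeff_error_le m) auto
  finally show ?thesis by (simp add: b_def algebra_simps)
qed

end

section \<open>Balancing bias and variance\<close>

theorem theorem1p2:
  fixes A s C :: real
    and \<rho> :: "((real ^ 'd) \<times> real) measure"
    and \<kappa> :: "real ^ 'd \<Rightarrow> real measure"
    and T :: "nat \<Rightarrow> 'v set"
    and M :: "nat \<Rightarrow> 'v \<Rightarrow> real ^ 'd \<Rightarrow> real"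
  defines "\<rho>X \<equiv> marginal unit_cube \<rho>"
    and "f\<rho> \<equiv> regression \<kappa>"
  assumes "A > 0" and "s > 0"
    and "borel_probability_on (unit_cube \<times> {-A..A}) \<rho>"
    and "disintegration unit_cube {-A..A} \<rho> \<kappa>"
    and "f\<rho> \<in> approx_class \<rho>X s"
    and "\<And>N. N \<ge> 1 \<Longrightarrow> admissible \<rho>X (T N) (M N)"
    and "\<And>N. N \<ge> 1 \<Longrightarrow> card (T N) = N"
    and "\<And>N. N \<ge> 1 \<Longrightarrow>
           L2_norm \<rho>X (\<lambda>x. f\<rho> x - Q_op \<rho>X (T N) (M N) f\<rho> x) \<le> C * real N powr (- s)"
  shows "\<exists>C'. \<forall>m\<ge>1. \<forall>N. N = nat \<lfloor>real m powr (1 / (1 + 2 * s))\<rfloor> \<longrightarrow>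
           (\<integral>z. (L2_norm \<rho>X (\<lambda>x. f\<rho> x - estimator (T N) (M N) m z x))\<^sup>2 \<partial>sample_measure m \<rho>)
             \<le> C' * real m powr (- (2 * s / (1 + 2 * s)))"
proof -
  interpret bounded_regression unit_cube A \<rho> \<kappa>
    using assms by unfold_locales auto
  define p where "p m = real m powr (- (2 * s / (1 + 2 * s)))" for m :: nat
  \<comment> \<open>The first summand is twice the squared bias bound, including the loss from the
    integer part; the second is the variance constant.\<close>
  define C' where "C' = 2 * C\<^sup>2 * 2 powr (2 * s) + 32 * A\<^sup>2"
  show ?thesis
  proof (intro exI[of _ C'] allI impI)
    fix m N :: nat
    assume m: "m \<ge> 1" and N: "N = nat \<lfloor>real m powr (1 / (1 + 2 * s))\<rfloor>"
    note rate = floor_powr_rate[OF \<open>s > 0\<close> m N, folded p_def]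
    let ?b = "L2_norm \<rho>X (\<lambda>x. f\<rho> x - Q_op \<rho>X (T N) (M N) f\<rho> x)"
    have "?b\<^sup>2 \<le> (C * real N powr (- s))\<^sup>2"
      using assms(10)[OF rate(1)] by (intro power_mono) (auto simp: L2_norm_def)
    also have "\<dots> \<le> C\<^sup>2 * (2 powr (2 * s) * p m)"
      using rate(2) by (simp add: power_mult_distrib mult_left_mono)
    finally have b: "?b\<^sup>2 \<le> C\<^sup>2 * (2 powr (2 * s) * p m)" .
    have "(\<integral>z. (L2_norm \<rho>X (\<lambda>x. f\<rho> x - estimator (T N) (M N) m z x))\<^sup>2 \<partial>sample_measure m \<rho>)
        \<le> 2 * ?b\<^sup>2 + 32 * A\<^sup>2 * (real N / real m)"
      using expected_risk_le[OF assms(8)[OF rate(1), unfolded \<rho>X_def] m] assms(9)[OF rate(1)]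
      by (simp add: \<rho>X_def f\<rho>_def)
    also have "\<dots> \<le> 2 * (C\<^sup>2 * (2 powr (2 * s) * p m)) + 32 * A\<^sup>2 * p m"
      using b rate(3) by (intro add_mono mult_left_mono) auto
    also have "\<dots> = C' * p m" by (simp add: C'_def algebra_simps)
    finally show "(\<integral>z. (L2_norm \<rho>X (\<lambda>x. f\<rho> x - estimator (T N) (M N) m z x))\<^sup>2 \<partial>sample_measure m \<rho>)
        \<le> C' * real m powr (- (2 * s / (1 + 2 * s)))" by (simp add: p_def)
  qed
qed

end
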